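(* Let $\mathcal{F}=(m_{ij})_{i,j}$ be an infinite frieze with quiddity row $(a_i)_{i\in\mathbb{Z}}$ and let $k$ be a fixed integer. Then for every $b\in\mathbb{Z}_{>0}$, the sequence $(a'_i)_{i\in\mathbb{Z}}$ defined by $a'_k=a_k+b$ and $a'_i=a_i$ for $i\neq k$ is the quiddity row of an infinite frieze. At position $(i,j)$ the entry of this new frieze is $$m_{ij}+b\,m_{i,k-1}\,m_{k+1,j}.$$ In particular, outside the cone with peak at position $(k,k)$ (that is, at all positions $(i,j)$ for which $i\le k\le j$ fails), the entries of the new frieze coincide with those of $\mathcal{F}$.
   Context: An infinite frieze (of positive integers) is an array $\mathcal{F}=(m_{ij})_{i,j\in\mathbb{Z},\,j\ge i-2}$ such that $m_{i,i-2}=0$, $m_{i,i-1}=1$ for all $i$, $m_{ij}\in\mathbb{Z}_{>0}$ for all $i\le j$, and the unimodular rule $m_{ij}m_{i+1,j+1}-m_{i+1,j}m_{i,j+1}=1$ holds for every diamond $m_{ij},m_{i+1,j},m_{i,j+1},m_{i+1,j+1}$ of the array (i.e. for all $i,j$ with $j\ge i-1$). By convention $m_{ij}=0$ for all $(i,j)$ with $i>j+2$. The quiddity row of $\mathcal{F}$ is $(a_i)_{i\in\mathbb{Z}}$ with $a_i=m_{ii}$. *)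

theory Defs
  imports Main
begin

text \<open>
  The array is indexed by the positions \<open>(i, j)\<close> with \<open>j \<ge> i - 2\<close>. It is represented by a
  total function on pairs of integers, extended by \<open>0\<close> to the remaining positions (those with
  \<open>i > j + 2\<close>), so that a frieze is determined by the entries of its array.
\<close>

definition infinite_frieze :: "(int \<Rightarrow> int \<Rightarrow> int) \<Rightarrow> bool" where
  "infinite_frieze m \<longleftrightarrow>
     (\<forall>i. m i (i - 2) = 0) \<and>
     (\<forall>i. m i (i - 1) = 1) \<and>
     (\<forall>i j. i \<le> j \<longrightarrow> m i j > 0) \<and>
     (\<forall>i j. j \<ge> i - 1 \<longrightarrow> m i j * m (i + 1) (j + 1) - m (i + 1) j * m i (j + 1) = 1) \<and>
     (\<forall>i j. i > j + 2 \<longrightarrow> m i j = 0)"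

definition quiddity_row :: "(int \<Rightarrow> int \<Rightarrow> int) \<Rightarrow> int \<Rightarrow> int" where
  "quiddity_row m = (\<lambda>i. m i i)"

end

theory Submission
  imports Defs
begin

text \<open>
  Comparing the diamonds \<open>(i, j)\<close> and \<open>(i + 1, j)\<close> shows that the columns of a frieze satisfy the
  linear recurrence \<open>m\<^bsub>i,j\<^esub> = a\<^sub>i m\<^bsub>i+1,j\<^esub> - m\<^bsub>i+2,j\<^esub>\<close>. Hence the minor of two adjacent columns with
  rows \<open>i\<close> and \<open>l\<close> is, as a function of \<open>i\<close>, a solution of the recurrence with the same initial
  values as column \<open>l - 2\<close>, so it equals \<open>m\<^bsub>i,l-2\<^esub>\<close>. With \<open>l = k + 1\<close>, the part of a
  diamond of the new array that is linear in \<open>b\<close> cancels; the part quadratic in \<open>b\<close> is the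
  determinant of a matrix of rank one. Finally, a frieze is determined by its quiddity row, since the
  unimodular rule can be solved for the bottom entry of each diamond.
\<close>

text \<open>The zero convention absorbs the row \<open>j = i - 2\<close>, and positivity extends to
  the row of ones, so that later divisions by entries need no boundary case.\<close>

lemma infinite_friezeD:
  assumes "infinite_frieze m"
  shows infinite_frieze_0: "j \<le> i - 2 \<Longrightarrow> m i j = 0"
    and infinite_frieze_1: "m i (i - 1) = 1"
    and infinite_frieze_pos: "i \<le> j + 1 \<Longrightarrow> m i j > 0"
    and infinite_frieze_diamond:
      "i \<le> j + 1 \<Longrightarrow> m i j * m (i + 1) (j + 1) - m (i + 1) j * m i (j + 1) = 1"
    and infinite_frieze_nonneg: "m i j \<ge> 0"
proof -
  have zero: "m i j = 0" if "j \<le> i - 2" for i j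
  proof (cases "j = i - 2")
    case False
    with that assms show ?thesis by (simp add: infinite_frieze_def)
  qed (use assms in \<open>simp add: infinite_frieze_def\<close>)
  have one: "m i (i - 1) = 1" for i
    using assms by (simp add: infinite_frieze_def)
  have pos: "m i j > 0" if "i \<le> j + 1" for i j
  proof (cases "j = i - 1")
    case False
    with that assms show ?thesis by (simp add: infinite_frieze_def)
  qed (simp add: one)
  show "j \<le> i - 2 \<Longrightarrow> m i j = 0" by (rule zero)
  show "m i (i - 1) = 1" by (rule one)
  show "i \<le> j + 1 \<Longrightarrow> m i j > 0" by (rule pos)
  show "i \<le> j + 1 \<Longrightarrow> m i j * m (i + 1) (j + 1) - m (i + 1) j * m i (j + 1) = 1"
    using assms by (simp add: infinite_frieze_def)
  show "m i j \<ge> 0"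
    using zero[of j i] pos[of i j] by (cases "i \<le> j + 1") auto
qed

lemma infinite_frieze_recurrence:
  assumes m: "infinite_frieze m" and "i \<le> j"
  shows "m i j = m i i * m (i + 1) j - m (i + 2) j"
  using \<open>i \<le> j\<close>
proof (induction j rule: int_ge_induct)
  case base
  show ?case
    using infinite_frieze_0[OF m, of i "i + 2"] infinite_frieze_1[OF m, of "i + 1"] by simp
next
  case (step j)
  have "m i j * m (i + 1) (j + 1) - m (i + 1) j * m i (j + 1) = 1"
    using infinite_frieze_diamond[OF m, of i j] step.hyps by simp
  moreover have "m (i + 1) j * m (i + 2) (j + 1) - m (i + 2) j * m (i + 1) (j + 1) = 1"
    using infinite_frieze_diamond[OF m, of "i + 1" j] step.hyps by (simp add: add.commute)
  \<comment> \<open>Equating the two diamonds and inserting the induction hypothesis gives the claim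
    times \<open>m (i + 1) j\<close>, which is then cancelled.\<close>
  ultimately have "m (i + 1) j * m i (j + 1)
      = m (i + 1) j * (m i i * m (i + 1) (j + 1) - m (i + 2) (j + 1))"
    using step.IH by algebra
  moreover have "m (i + 1) j > 0"
    using infinite_frieze_pos[OF m, of "i + 1" j] step.hyps by simp
  ultimately show ?case by simp
qed

lemma infinite_frieze_minor:
  assumes m: "infinite_frieze m" and "i \<le> l" "l \<le> j + 2"
  shows "m i j * m l (j + 1) - m i (j + 1) * m l j = m i (l - 2)"
proof -
  define P where
    "P i \<longleftrightarrow> m i j * m l (j + 1) - m i (j + 1) * m l j = m i (l - 2)" for i
  \<comment> \<open>The recurrence has order two, so the downward induction from \<open>l\<close>
    carries two consecutive rows.\<close>
  have "P i \<and> P (i - 1)"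
    using \<open>i \<le> l\<close>
  proof (induction i rule: int_le_induct)
    case base
    have "P l"
      using infinite_frieze_0[OF m, of "l - 2" l] by (simp add: P_def)
    moreover have "P (l - 1)"
      using infinite_frieze_diamond[OF m, of "l - 1" j] infinite_frieze_1[OF m, of "l - 1"]
        \<open>l \<le> j + 2\<close> by (simp add: P_def mult.commute)
    ultimately show ?case ..
  next
    case (step i)
    have rec: "m (i - 2) n = m (i - 2) (i - 2) * m (i - 1) n - m i n" if "i - 2 \<le> n" for n
      using infinite_frieze_recurrence[OF m that] by simp
    \<comment> \<open>All three columns have index at least \<open>i - 2\<close>, because
      \<open>i \<le> l \<le> j + 2\<close>.\<close>
    have "m (i - 2) j = m (i - 2) (i - 2) * m (i - 1) j - m i j"
      "m (i - 2) (j + 1) = m (i - 2) (i - 2) * m (i - 1) (j + 1) - m i (j + 1)"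
      "m (i - 2) (l - 2) = m (i - 2) (i - 2) * m (i - 1) (l - 2) - m i (l - 2)"
      by (rule rec; use step.hyps \<open>l \<le> j + 2\<close> in simp)+
    moreover have "P i" "P (i - 1)"
      using step.IH by simp_all
    ultimately have "P (i - 2)"
      unfolding P_def by algebra
    with step.IH show ?case by simp
  qed
  then show ?thesis by (simp add: P_def)
qed

lemma infinite_frieze_unique:
  assumes m: "infinite_frieze m" and n: "infinite_frieze n"
    and quiddity: "quiddity_row m = quiddity_row n"
  shows "m = n"
proof -
  have "m i j = n i j" for i j
  proof (induction "nat (j - i + 1)" arbitrary: i j rule: less_induct)
    case less
    consider "j \<le> i - 2" | "j = i - 1" | "j = i" | "i < j" by linarith
    then show ?case
    proof cases
      case 1
      then show ?thesis by (simp add: infinite_frieze_0[OF m] infinite_frieze_0[OF n])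
    next
      case 2
      then show ?thesis by (simp add: infinite_frieze_1[OF m] infinite_frieze_1[OF n])
    next
      case 3
      then show ?thesis using fun_cong[OF quiddity, of i] by (simp add: quiddity_row_def)
    next
      case 4
      have eq: "m i (j - 1) = n i (j - 1)" "m (i + 1) j = n (i + 1) j"
        "m (i + 1) (j - 1) = n (i + 1) (j - 1)"
        by (rule less; use 4 in simp)+
      \<comment> \<open>In the diamond at \<open>(i, j - 1)\<close> the other three entries have a
        smaller difference of indices, so they already agree.\<close>
      have "n i (j - 1) * n (i + 1) j - n (i + 1) (j - 1) * m i j = 1"
        using infinite_frieze_diamond[OF m, of i "j - 1"] 4 by (simp add: eq)
      moreover have "n i (j - 1) * n (i + 1) j - n (i + 1) (j - 1) * n i j = 1"
        using infinite_frieze_diamond[OF n, of i "j - 1"] 4 by simp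
      ultimately have "n (i + 1) (j - 1) * m i j = n (i + 1) (j - 1) * n i j"
        by linarith
      moreover have "n (i + 1) (j - 1) > 0"
        using infinite_frieze_pos[OF n, of "i + 1" "j - 1"] 4 by simp
      ultimately show ?thesis by simp
    qed
  qed
  then show ?thesis by blast
qed

definition modified_frieze :: "(int \<Rightarrow> int \<Rightarrow> int) \<Rightarrow> int \<Rightarrow> int \<Rightarrow> int \<Rightarrow> int \<Rightarrow> int" where
  "modified_frieze m k b i j = m i j + b * m i (k - 1) * m (k + 1) j"

text \<open>The factor \<open>m i (k - 1)\<close> vanishes for \<open>k < i\<close>, and
  \<open>m (k + 1) j\<close> vanishes for \<open>j < k\<close>.\<close>

lemma modified_frieze_outside_cone:
  assumes "infinite_frieze m" and "\<not> (i \<le> k \<and> k \<le> j)"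
  shows "modified_frieze m k b i j = m i j"
  using assms(2) infinite_frieze_0[OF assms(1), of "k - 1" i]
    infinite_frieze_0[OF assms(1), of j "k + 1"]
  by (auto simp: modified_frieze_def)

lemma modified_frieze_diamond:
  assumes m: "infinite_frieze m" and "i \<le> j + 1"
  shows "modified_frieze m k b i j * modified_frieze m k b (i + 1) (j + 1)
    - modified_frieze m k b (i + 1) j * modified_frieze m k b i (j + 1) = 1"
proof -
  have diamond: "m i j * m (i + 1) (j + 1) - m (i + 1) j * m i (j + 1) = 1"
    by (rule infinite_frieze_diamond) fact+
  show ?thesis
  \<comment> \<open>In this range the minor formula applies to rows \<open>i\<close> and
    \<open>i + 1\<close>; otherwise all four positions of the diamond lie outside the cone.\<close>
  proof (cases "i \<le> k \<and> k \<le> j + 1")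
    case True
    have "m i j * m (k + 1) (j + 1) - m i (j + 1) * m (k + 1) j = m i (k - 1)"
      using infinite_frieze_minor[OF m, of i "k + 1" j] True by simp
    moreover have "m (i + 1) j * m (k + 1) (j + 1) - m (i + 1) (j + 1) * m (k + 1) j
        = m (i + 1) (k - 1)"
      using infinite_frieze_minor[OF m, of "i + 1" "k + 1" j] True by simp
    \<comment> \<open>The difference of the two sides is the coefficient of \<open>b\<close> in the
      new diamond.\<close>
    ultimately have "m (i + 1) (k - 1)
        * (m i j * m (k + 1) (j + 1) - m i (j + 1) * m (k + 1) j)
      = m i (k - 1)
        * (m (i + 1) j * m (k + 1) (j + 1) - m (i + 1) (j + 1) * m (k + 1) j)"
      by simp
    with diamond show ?thesis
      unfolding modified_frieze_def by algebra
  next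
    case False
    then show ?thesis
      using diamond by (auto simp: modified_frieze_outside_cone[OF m])
  qed
qed

lemma infinite_frieze_modified_frieze:
  assumes m: "infinite_frieze m" and "b \<ge> 0"
  shows "infinite_frieze (modified_frieze m k b)"
  unfolding infinite_frieze_def
proof (intro conjI allI impI)
  fix i j :: int
  show "modified_frieze m k b i (i - 2) = 0"
    by (simp add: modified_frieze_outside_cone[OF m] infinite_frieze_0[OF m])
  show "modified_frieze m k b i (i - 1) = 1"
    by (simp add: modified_frieze_outside_cone[OF m] infinite_frieze_1[OF m])
  show "modified_frieze m k b i j > 0" if "i \<le> j"
    unfolding modified_frieze_def using that \<open>b \<ge> 0\<close>
    by (intro add_pos_nonneg mult_nonneg_nonneg infinite_frieze_pos[OF m]
        infinite_frieze_nonneg[OF m]) simp_all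
  show "modified_frieze m k b i j * modified_frieze m k b (i + 1) (j + 1)
    - modified_frieze m k b (i + 1) j * modified_frieze m k b i (j + 1) = 1" if "i - 1 \<le> j"
    using modified_frieze_diamond[OF m, of i j k b] that by simp
  show "modified_frieze m k b i j = 0" if "j + 2 < i"
    using that by (simp add: modified_frieze_outside_cone[OF m] infinite_frieze_0[OF m])
qed

text \<open>At \<open>(k, k)\<close> both factors of the correction lie in the row of ones; every
  other \<open>(i, i)\<close> is outside the cone.\<close>

lemma quiddity_row_modified_frieze:
  assumes "infinite_frieze m"
  shows "quiddity_row (modified_frieze m k b)
    = (quiddity_row m)(k := quiddity_row m k + b)"
proof
  fix i
  show "quiddity_row (modified_frieze m k b) i
    = ((quiddity_row m)(k := quiddity_row m k + b)) i"
  proof (cases "i = k")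
    case True
    then show ?thesis
      using infinite_frieze_1[OF assms, of k] infinite_frieze_1[OF assms, of "k + 1"]
      by (simp add: quiddity_row_def modified_frieze_def)
  next
    case False
    then show ?thesis
      by (auto simp: quiddity_row_def modified_frieze_outside_cone[OF assms])
  qed
qed

theorem theorem2p1:
  fixes m :: "int \<Rightarrow> int \<Rightarrow> int" and a a' :: "int \<Rightarrow> int" and k b :: int
  assumes "infinite_frieze m"
    and "quiddity_row m = a"
    and "b > 0"
    and "a' k = a k + b"
    and "\<And>i. i \<noteq> k \<Longrightarrow> a' i = a i"
  shows "(\<exists>m'. infinite_frieze m' \<and> quiddity_row m' = a') \<and>
         (\<forall>m'. infinite_frieze m' \<and> quiddity_row m' = a' \<longrightarrow>
            (\<forall>i j. m' i j = m i j + b * m i (k - 1) * m (k + 1) j) \<and>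
            (\<forall>i j. \<not> (i \<le> k \<and> k \<le> j) \<longrightarrow> m' i j = m i j))"
proof -
  let ?m = "modified_frieze m k b"
  have frieze: "infinite_frieze ?m"
    using infinite_frieze_modified_frieze assms(1,3) by simp
  have "a' = a(k := a k + b)"
    using assms(4,5) by auto
  with assms(1,2) have quiddity: "quiddity_row ?m = a'"
    by (simp add: quiddity_row_modified_frieze)
  \<comment> \<open>Uniqueness carries the explicit formula over to every frieze with quiddity row
    \<open>a'\<close>.\<close>
  have unique: "m' = ?m" if "infinite_frieze m' \<and> quiddity_row m' = a'" for m'
    using that infinite_frieze_unique frieze quiddity by blast
  show ?thesis
  proof (intro conjI allI impI)
    show "\<exists>m'. infinite_frieze m' \<and> quiddity_row m' = a'"
      using frieze quiddity by blast
  next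
    fix m' i j
    assume "infinite_frieze m' \<and> quiddity_row m' = a'"
    then have m': "m' = ?m" by (rule unique)
    show "m' i j = m i j + b * m i (k - 1) * m (k + 1) j"
      by (simp add: m' modified_frieze_def)
    show "m' i j = m i j" if "\<not> (i \<le> k \<and> k \<le> j)"
      using modified_frieze_outside_cone[OF assms(1) that] by (simp add: m')
  qed
qed

end
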